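(* For every $\alpha>1$ there exists at least one instance $\mathcal G=(m,A,\boldsymbol r,\boldsymbol\tau,u)$ of the stateless mean field game with power law discounting $u(r,t)=rt^{-\alpha}$ and with continuous and rate monotonous sojourn-time function $\boldsymbol\tau$ that has no stationary equilibrium, i.e., $\mathcal S(\mathcal G)=\emptyset$.
   Context: Game data: a total mass $m>0$ of nonatomic agents; a finite action set $A=\{1,\dots,n\}$, $n\ge2$; rewards $\boldsymbol r=(r_i)_{i\in A}$, $r_i>0$; for $s>0$ put $\mathcal U_s(A)=\{\boldsymbol\mu\in\mathbb R_{\ge0}^n\mid\sum_{i\in A}\mu_i=s\}$; sojourn-time functions $\tau_i:\bigcup_{s>0}\mathcal U_s(A)\to(0,\infty)$, $\boldsymbol\tau=(\tau_i)_{i\in A}$; a utility function $u(r,t)$ (present value of reward $r$ received at time $t$). The action rates are $x_i(\boldsymbol\mu)=\mu_i/\tau_i(\boldsymbol\mu)$. Continuous and rate monotonous: $\boldsymbol\tau$ is continuous on each $\mathcal U_s(A)$, and for all $\boldsymbol\mu,\boldsymbol\mu'\in\bigcup_{s>0}\mathcal U_s(A)$ and all $i\in A$, $x_i(\boldsymbol\mu)<x_i(\boldsymbol\mu')$ implies $\tau_i(\boldsymbol\mu)\le\tau_i(\boldsymbol\mu')$. Strategies: $\mathcal P(A)$ is the set of probability vectors on $A$. A strategy is a sequence $\boldsymbol\sigma=(\sigma_k)_{k\ge1}\in\mathcal P(A)^{\mathbb N}$; the $k$th action $a_k$ is drawn from $\sigma_k$, independently over $k$. It is stationary if $\sigma_k$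 does not depend on $k$ (then identified with an element of $\mathcal P(A)$). Given a vector of sojourn times $\boldsymbol\tau=(\tau_i)_{i\in A}$, the expected total utility is $$V(\boldsymbol\sigma,\boldsymbol\tau)=\mathbb E_{\boldsymbol\sigma}\Big[\sum_{k=1}^\infty u\Big(r_{a_k},\sum_{j=1}^k\tau_{a_j}\Big)\Big]$$ (finite when $\alpha>1$). Stationary equilibrium: a mass distribution $\boldsymbol\mu^\dagger\in\mathcal U_m(A)$ for which there is $\sigma^\dagger\in\mathcal P(A)$ such that (a) $\mu_i^\dagger=\theta\,\sigma^\dagger(i)\,\tau_i(\boldsymbol\mu^\dagger)$ for all $i\in A$, for some normalizing constant $\theta$, and (b) $V(\sigma^\dagger,\boldsymbol\tau(\boldsymbol\mu^\dagger))=\sup_{\boldsymbol\sigma\in\mathcal P(A)^{\mathbb N}}V(\boldsymbol\sigma,\boldsymbol\tau(\boldsymbol\mu^\dagger))$. $\mathcal S(\mathcal G)$ is the set of stationary equilibria. *)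

theory Defs
  imports "HOL-Probability.Probability"
begin

text \<open>
  Vectors indexed by the action set \<open>A = {1..n}\<close> are functions on \<^typ>\<open>nat\<close>. Mass distributions
  are taken extensional on \<open>A\<close>, so that they correspond exactly to vectors in \<open>\<real>\<^sup>n\<close> and a
  sojourn-time function cannot depend on values outside \<open>A\<close>.
\<close>

definition mass_distributions :: "nat set \<Rightarrow> real \<Rightarrow> (nat \<Rightarrow> real) set" where
  "mass_distributions A s = {\<mu> \<in> A \<rightarrow>\<^sub>E {0..}. (\<Sum>i\<in>A. \<mu> i) = s}"

definition all_mass_distributions :: "nat set \<Rightarrow> (nat \<Rightarrow> real) set" where
  "all_mass_distributions A = (\<Union>s\<in>{0<..}. mass_distributions A s)"

text \<open>\<open>sojourn G i \<mu>\<close> is \<open>\<tau>\<^sub>i(\<mu>)\<close>; only its values for \<open>i \<in> A\<close> and mass distributions \<open>\<mu>\<close> are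
  meaningful.\<close>

record game =
  mass :: real
  num_actions :: nat
  reward :: "nat \<Rightarrow> real"
  sojourn :: "nat \<Rightarrow> (nat \<Rightarrow> real) \<Rightarrow> real"
  utility :: "real \<Rightarrow> real \<Rightarrow> real"

definition actions :: "game \<Rightarrow> nat set" where
  "actions G = {1..num_actions G}"

definition stateless_mean_field_game :: "game \<Rightarrow> bool" where
  "stateless_mean_field_game G \<longleftrightarrow>
     mass G > 0 \<and> num_actions G \<ge> 2 \<and>
     (\<forall>i\<in>actions G. reward G i > 0) \<and>
     (\<forall>i\<in>actions G. \<forall>\<mu>\<in>all_mass_distributions (actions G). sojourn G i \<mu> > 0)"

definition action_rate :: "game \<Rightarrow> nat \<Rightarrow> (nat \<Rightarrow> real) \<Rightarrow> real" where
  "action_rate G i \<mu> = \<mu> i / sojourn G i \<mu>"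

text \<open>Continuity refers to the product topology on \<^typ>\<open>nat \<Rightarrow> real\<close>, which on extensional
  functions over the finite set \<open>A\<close> is the Euclidean topology of \<open>\<real>\<^sup>n\<close>.\<close>

definition continuous_sojourn :: "game \<Rightarrow> bool" where
  "continuous_sojourn G \<longleftrightarrow>
     (\<forall>s>0. \<forall>i\<in>actions G. continuous_on (mass_distributions (actions G) s) (sojourn G i))"

definition rate_monotonous :: "game \<Rightarrow> bool" where
  "rate_monotonous G \<longleftrightarrow>
     (\<forall>\<mu>\<in>all_mass_distributions (actions G). \<forall>\<mu>'\<in>all_mass_distributions (actions G).
        \<forall>i\<in>actions G.
          action_rate G i \<mu> < action_rate G i \<mu>' \<longrightarrow> sojourn G i \<mu> \<le> sojourn G i \<mu>')"

definition prob_vectors :: "nat set \<Rightarrow> nat pmf set" where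
  "prob_vectors A = {p. set_pmf p \<subseteq> A}"

text \<open>Sequences are indexed from 0: \<open>\<sigma> k\<close> and \<open>a k\<close> are the law and the outcome of action number
  \<open>k + 1\<close>.\<close>

definition strategies :: "nat set \<Rightarrow> (nat \<Rightarrow> nat pmf) set" where
  "strategies A = {\<sigma>. \<forall>k. \<sigma> k \<in> prob_vectors A}"

text \<open>The product measure is the law of the action sequence under independent draws.
  The real-valued integral, and the supremum below, are only meaningful when the total utilities
  are finite and bounded; this holds for power law discounting with exponent \<open>\<alpha> > 1\<close> and
  positive sojourn times.\<close>

definition total_utility ::
    "game \<Rightarrow> (nat \<Rightarrow> nat pmf) \<Rightarrow> (nat \<Rightarrow> real) \<Rightarrow> real" where
  "total_utility G \<sigma> t =
     (\<integral>a. (\<Sum>k. utility G (reward G (a k)) (\<Sum>j\<le>k. t (a j)))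
        \<partial>(\<Pi>\<^sub>M k\<in>UNIV. measure_pmf (\<sigma> k)))"

definition stationary_equilibria :: "game \<Rightarrow> (nat \<Rightarrow> real) set" where
  "stationary_equilibria G =
     {\<mu> \<in> mass_distributions (actions G) (mass G).
        \<exists>p\<in>prob_vectors (actions G).
          (\<exists>\<theta>. \<forall>i\<in>actions G. \<mu> i = \<theta> * pmf p i * sojourn G i \<mu>) \<and>
          total_utility G (\<lambda>_. p) (\<lambda>i. sojourn G i \<mu>) =
            (SUP \<sigma>\<in>strategies (actions G). total_utility G \<sigma> (\<lambda>i. sojourn G i \<mu>))}"

definition power_law_utility :: "real \<Rightarrow> real \<Rightarrow> real \<Rightarrow> real" where
  "power_law_utility \<alpha> r t = r * t powr (- \<alpha>)"

end

theory Submission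
  imports Defs
begin

text \<open>
  Constant sojourn times suffice. Action 1 pays 1 every time unit, action 2 pays \<open>R\<close> every two time
  units, with \<open>2 < R < 2\<^sup>\<alpha>\<close>. As power law discounting flattens out, action 2 with its higher reward
  rate \<open>R/2 > 1\<close> is better in the long run: playing 1 for a long time and 2 ever after beats always
  playing 1. As \<open>R < 2\<^sup>\<alpha>\<close>, always playing 1 beats always playing 2. Hence neither constant
  sequence is optimal. If a stationary strategy \<open>p\<close> were optimal, almost every sequence drawn from
  \<open>p\<close> would be optimal; the total utility is continuous in the sequence, and for \<open>p(i) > 0\<close>
  every neighbourhood of the constant sequence \<open>i\<close> has positive probability, so this constant
  sequence would be optimal.
\<close>

lemma suminf_strict_mono:
  fixes f g :: "nat \<Rightarrow> real"
  assumes less: "\<And>k. f k < g k" and f: "summable f" and g: "summable g"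
  shows "suminf f < suminf g"
proof -
  have "0 < (\<Sum>k. g k - f k)"
    using less by (intro suminf_pos summable_diff f g) simp
  then show ?thesis
    by (simp add: suminf_diff[OF g f, symmetric])
qed

section \<open>Total utility of a fixed action sequence\<close>

locale power_law_rewards =
  fixes \<alpha> R :: real and r t :: "nat \<Rightarrow> real"
  assumes \<alpha>_gt_1: "\<alpha> > 1"
    and r_nonneg: "\<And>i. 0 \<le> r i" and r_le: "\<And>i. r i \<le> R"
    and t_ge_1: "\<And>i. 1 \<le> t i"
begin

definition stage_utility :: "(nat \<Rightarrow> nat) \<Rightarrow> nat \<Rightarrow> real" where
  "stage_utility a k = power_law_utility \<alpha> (r (a k)) (\<Sum>j\<le>k. t (a j))"

definition sequence_utility :: "(nat \<Rightarrow> nat) \<Rightarrow> real" where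
  "sequence_utility a = (\<Sum>k. stage_utility a k)"

definition expected_utility :: "(nat \<Rightarrow> nat pmf) \<Rightarrow> real" where
  "expected_utility \<sigma> = (\<integral>a. sequence_utility a \<partial>(\<Pi>\<^sub>M k\<in>UNIV. measure_pmf (\<sigma> k)))"

text \<open>A majorant independent of the action sequence: \<open>Suc k\<close> actions take at
  least \<open>Suc k\<close> time units. Its summable tails control all sequences at once.\<close>

definition stage_bound :: "nat \<Rightarrow> real" where
  "stage_bound k = R * real (Suc k) powr (- \<alpha>)"

lemma stage_utility_nonneg: "0 \<le> stage_utility a k"
  by (simp add: stage_utility_def power_law_utility_def r_nonneg)

lemma stage_utility_le: "stage_utility a k \<le> stage_bound k"
proof -
  have "(\<Sum>j\<le>k. 1) \<le> (\<Sum>j\<le>k. t (a j))"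
    by (intro sum_mono t_ge_1)
  then have "(\<Sum>j\<le>k. t (a j)) powr (- \<alpha>) \<le> real (Suc k) powr (- \<alpha>)"
    using \<alpha>_gt_1 by (intro powr_mono2') auto
  then show ?thesis
    unfolding stage_utility_def stage_bound_def power_law_utility_def
    using r_nonneg[of "a k"] r_le[of "a k"] by (intro mult_mono) auto
qed

lemma summable_stage_bound: "summable stage_bound"
proof -
  have "summable (\<lambda>k. real k powr (- \<alpha>))"
    using \<alpha>_gt_1 by (simp add: summable_real_powr_iff)
  then have "summable (\<lambda>k. real (Suc k) powr (- \<alpha>))"
    by (subst summable_Suc_iff)
  then show ?thesis
    unfolding stage_bound_def by (rule summable_mult)
qed

lemma summable_stage_utility: "summable (stage_utility a)"
  by (rule summable_comparison_test[OF _ summable_stage_bound])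
    (use stage_utility_nonneg stage_utility_le in auto)

lemma sequence_utility_nonneg: "0 \<le> sequence_utility a"
  unfolding sequence_utility_def
  by (intro suminf_nonneg summable_stage_utility stage_utility_nonneg)

lemma sequence_utility_le: "sequence_utility a \<le> suminf stage_bound"
  unfolding sequence_utility_def
  by (intro suminf_le summable_stage_utility summable_stage_bound stage_utility_le)

text \<open>Uniform continuity in the sequence: the first \<open>n\<close> stages depend only on the
  first \<open>n\<close> actions, and later stages of \<open>a\<close> are dominated by
  \<open>stage_bound\<close>.\<close>

lemma sequence_utility_le_of_prefix:
  assumes "\<And>k. k < n \<Longrightarrow> a k = b k"
  shows "sequence_utility a \<le> sequence_utility b + (\<Sum>k. stage_bound (k + n))"
proof -
  have "sequence_utility a = (\<Sum>k. stage_utility a (k + n)) + (\<Sum>k<n. stage_utility a k)"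
    unfolding sequence_utility_def by (rule suminf_split_initial_segment[OF summable_stage_utility])
  also have "(\<Sum>k<n. stage_utility a k) = (\<Sum>k<n. stage_utility b k)"
    using assms by (intro sum.cong) (auto simp: stage_utility_def)
  also have "\<dots> \<le> sequence_utility b"
    unfolding sequence_utility_def
    by (intro sum_le_suminf summable_stage_utility stage_utility_nonneg) auto
  also have "(\<Sum>k. stage_utility a (k + n)) \<le> (\<Sum>k. stage_bound (k + n))"
    by (intro suminf_le stage_utility_le)
      (simp_all add: summable_iff_shift summable_stage_utility summable_stage_bound)
  finally show ?thesis
    by simp
qed

section \<open>Expected utility under independent draws\<close>

lemma sequence_utility_measurable [measurable]:
  "sequence_utility \<in> borel_measurable (\<Pi>\<^sub>M k\<in>UNIV. measure_pmf (\<sigma> k))"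
proof -
  have component [measurable]:
    "(\<lambda>a. f (a k)) \<in> borel_measurable (\<Pi>\<^sub>M k\<in>UNIV. measure_pmf (\<sigma> k))"
    for f :: "nat \<Rightarrow> real" and k
    by (rule measurable_compose[OF measurable_component_singleton]) auto
  show ?thesis
    unfolding sequence_utility_def[abs_def] stage_utility_def power_law_utility_def by measurable
qed

lemma integrable_sequence_utility:
  "integrable (\<Pi>\<^sub>M k\<in>UNIV. measure_pmf (\<sigma> k)) sequence_utility"
proof -
  interpret prob_space "\<Pi>\<^sub>M k\<in>UNIV. measure_pmf (\<sigma> k)"
    by (intro prob_space_PiM measure_pmf.prob_space_axioms)
  show ?thesis
    by (rule integrable_const_bound[where B = "suminf stage_bound"])
      (auto simp: sequence_utility_nonneg sequence_utility_le)
qed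

lemma expected_utility_le: "expected_utility \<sigma> \<le> suminf stage_bound"
proof -
  interpret prob_space "\<Pi>\<^sub>M k\<in>UNIV. measure_pmf (\<sigma> k)"
    by (intro prob_space_PiM measure_pmf.prob_space_axioms)
  show ?thesis
    unfolding expected_utility_def
    by (rule integral_le_const) (auto simp: integrable_sequence_utility sequence_utility_le)
qed

text \<open>Embeds deterministic sequences into the strategies, so that an optimal strategy bounds
  the utility of every single sequence.\<close>

lemma expected_utility_return_pmf:
  "expected_utility (\<lambda>k. return_pmf (a k)) = sequence_utility a"
proof -
  let ?P = "\<Pi>\<^sub>M k\<in>UNIV. measure_pmf (return_pmf (a k))"
  interpret prob_space ?P
    by (intro prob_space_PiM measure_pmf.prob_space_axioms)
  have "AE b in ?P. b k = a k" for k
    by (rule AE_PiM_component) (auto simp: measure_pmf.prob_space_axioms AE_measure_pmf_iff)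
  then have "AE b in ?P. \<forall>k. b k = a k"
    by (simp add: AE_all_countable)
  then have "AE b in ?P. sequence_utility b = sequence_utility a"
    by eventually_elim (auto intro: arg_cong[where f = sequence_utility])
  then have "expected_utility (\<lambda>k. return_pmf (a k)) = (\<integral>b. sequence_utility a \<partial>?P)"
    unfolding expected_utility_def by (intro integral_cong_AE) auto
  then show ?thesis
    using prob_space by simp
qed

lemma constant_sequence_optimal:
  assumes opt: "\<And>a. sequence_utility a \<le> expected_utility (\<lambda>_. p)"
    and i: "pmf p i > 0"
  shows "sequence_utility (\<lambda>_. i) = expected_utility (\<lambda>_. p)"
proof (rule ccontr)
  let ?V = "expected_utility (\<lambda>_. p)" and ?P = "\<Pi>\<^sub>M k\<in>(UNIV :: nat set). measure_pmf p"
  interpret product_prob_space "\<lambda>_ :: nat. measure_pmf p" UNIV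
    by unfold_locales
  interpret P: prob_space ?P
    by (intro prob_space_PiM measure_pmf.prob_space_axioms)
  assume "sequence_utility (\<lambda>_. i) \<noteq> ?V"
  with opt[of "\<lambda>_. i"] have "0 < ?V - sequence_utility (\<lambda>_. i)"
    by simp
  \<comment> \<open>The tail after \<open>n\<close> is smaller than the utility gap, so every
    sequence starting with \<open>n\<close> copies of \<open>i\<close> stays strictly below
    \<open>?V\<close>.\<close>
  from suminf_exist_split[OF this summable_stage_bound] obtain n
    where n: "norm (\<Sum>k. stage_bound (k + n)) < ?V - sequence_utility (\<lambda>_. i)"
    by blast
  let ?C = "{a \<in> space ?P. \<forall>k\<in>{..<n}. a k \<in> {i}}"
  have less: "sequence_utility a < ?V" if "\<And>k. k < n \<Longrightarrow> a k = i" for a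
    using sequence_utility_le_of_prefix[of n a "\<lambda>_. i"] that n by force
  \<comment> \<open>The integrand is nonnegative by \<open>opt\<close> and has mean zero, hence
    vanishes almost everywhere.\<close>
  have "(\<integral>a. ?V - sequence_utility a \<partial>?P) = 0"
    using integrable_sequence_utility[of "\<lambda>_. p"] P.prob_space
    by (simp add: expected_utility_def)
  then have "AE a in ?P. ?V - sequence_utility a = 0"
    using integrable_sequence_utility[of "\<lambda>_. p"] opt
    by (subst (asm) integral_nonneg_eq_0_iff_AE) auto
  then have "AE a in ?P. a \<notin> ?C"
  proof eventually_elim
    case (elim a)
    then show ?case
      using less[of a] by auto
  qed
  moreover have "emeasure ?P ?C = ennreal (pmf p i) ^ n"
    by (subst emeasure_PiM_Collect) (auto simp: emeasure_pmf_single)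
  then have pos: "emeasure ?P ?C \<noteq> 0"
    using i by simp
  \<comment> \<open>Nonzero \<open>emeasure\<close> also yields that \<open>?C\<close> is
    measurable.\<close>
  ultimately have "?C \<in> null_sets ?P"
    by (subst AE_iff_null_sets[OF emeasure_neq_0_sets[OF pos]])
  with pos show False
    by (simp only: null_setsD1)
qed

end

section \<open>The instance with a fast action 1 and a slow action 2\<close>

locale slow_and_fast_action =
  fixes \<alpha> R :: real
  assumes exponent_gt_1: "\<alpha> > 1" and R_gt_2: "2 < R" and R_less: "R < 2 powr \<alpha>"
begin

sublocale power_law_rewards \<alpha> R "\<lambda>i. if i = 2 then R else 1" "\<lambda>i. if i = 2 then 2 else 1"
  by unfold_locales (use exponent_gt_1 R_gt_2 in auto)

text \<open>Doubling all times scales every stage by 2 to the power -\<alpha>, which the reward R <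
  2 powr \<alpha> does not make up for.\<close>

lemma slow_sequence_suboptimal: "sequence_utility (\<lambda>_. 2) < sequence_utility (\<lambda>_. 1)"
proof -
  have "stage_utility (\<lambda>_. 2) k < stage_utility (\<lambda>_. 1) k" for k
  proof -
    have "R * 2 powr (- \<alpha>) < 1"
      using R_less by (simp add: powr_minus divide_simps)
    then have "R * 2 powr (- \<alpha>) * real (Suc k) powr (- \<alpha>) < 1 * real (Suc k) powr (- \<alpha>)"
      by (intro mult_strict_right_mono) auto
    moreover have "(real (Suc k) * 2) powr (- \<alpha>) = real (Suc k) powr (- \<alpha>) * 2 powr (- \<alpha>)"
      by (rule powr_mult)
    ultimately show ?thesis
      by (simp add: stage_utility_def power_law_utility_def mult_ac)
  qed
  then show ?thesis
    unfolding sequence_utility_def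
    by (intro suminf_strict_mono summable_stage_utility)
qed

text \<open>After \<open>n\<close> fast actions, each slow action is matched with the two fast ones
  filling the same time. With \<open>x\<close> the end of the first of these, the slow action wins
  iff (1 + 1/x) powr \<alpha> < R - 1.\<close>

lemma fast_sequence_suboptimal:
  "\<exists>n. sequence_utility (\<lambda>_. 1) < sequence_utility (\<lambda>k. if k < n then 1 else 2)"
proof -
  \<comment> \<open>The limit 1 lies below R - 1 because R > 2.\<close>
  have "(\<lambda>n. (1 + 1 / real (Suc n)) powr \<alpha>) \<longlonglongrightarrow> (1 + 0) powr \<alpha>"
    by (intro tendsto_intros LIMSEQ_Suc lim_1_over_n) auto
  then have "\<forall>\<^sub>F n in sequentially. (1 + 1 / real (Suc n)) powr \<alpha> < R - 1"
    using R_gt_2 by (intro order_tendstoD) auto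
  then obtain n where n: "\<And>m. m \<ge> n \<Longrightarrow> (1 + 1 / real (Suc m)) powr \<alpha> < R - 1"
    by (auto simp: eventually_sequentially)
  let ?a = "\<lambda>_ :: nat. 1 :: nat" and ?b = "\<lambda>k. if k < n then 1 else 2 :: nat"
  have less: "sum (\<lambda>j. stage_utility ?a (j + n)) {k * 2..<k * 2 + 2} < stage_utility ?b (k + n)" for k
  proof -
    \<comment> \<open>The two fast actions end at \<open>x\<close> and \<open>x + 1\<close>, the
      slow one at \<open>x + 1\<close>.\<close>
    define x where "x = real (Suc (n + 2 * k))"
    have x: "x > 0"
      by (simp add: x_def)
    have "{..k + n} = {..<n} \<union> {n..k + n}"
      by auto
    then have "(\<Sum>j\<le>k + n. if ?b j = 2 then 2 else 1 :: real)
        = (\<Sum>j<n. if ?b j = 2 then 2 else 1) + (\<Sum>j=n..k + n. if ?b j = 2 then 2 else 1)"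
      by (simp only:) (intro sum.union_disjoint; auto)
    also have "\<dots> = (\<Sum>j<n. 1) + (\<Sum>j=n..k + n. 2)"
      by (intro arg_cong2[where f = "(+)"] sum.cong) auto
    also have "\<dots> = x + 1"
      by (simp add: x_def)
    finally have b: "stage_utility ?b (k + n) = R * (x + 1) powr (- \<alpha>)"
      by (simp add: stage_utility_def power_law_utility_def)
    have a: "sum (\<lambda>j. stage_utility ?a (j + n)) {k * 2..<k * 2 + 2}
        = x powr (- \<alpha>) + (x + 1) powr (- \<alpha>)"
      by (simp add: stage_utility_def power_law_utility_def x_def algebra_simps)
    have "x * (1 + 1 / x) = x + 1"
      using x by (simp add: field_simps)
    then have "(x + 1) powr \<alpha> = x powr \<alpha> * (1 + 1 / x) powr \<alpha>"
      by (metis powr_mult)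
    also have "\<dots> < x powr \<alpha> * (R - 1)"
      using n[of "n + 2 * k"] x by (intro mult_strict_left_mono) (auto simp: x_def)
    finally have "x powr (- \<alpha>) < (R - 1) * (x + 1) powr (- \<alpha>)"
      using x by (simp add: powr_minus field_simps)
    then show ?thesis
      unfolding a b by (simp add: algebra_simps)
  qed
  have summable_a: "summable (\<lambda>k. stage_utility ?a (k + n))"
    and summable_b: "summable (\<lambda>k. stage_utility ?b (k + n))"
    by (simp_all only: summable_iff_shift summable_stage_utility)
  have grouped: "(\<lambda>k. sum (\<lambda>j. stage_utility ?a (j + n)) {k * 2..<k * 2 + 2})
      sums (\<Sum>k. stage_utility ?a (k + n))"
    by (rule sums_group[OF summable_sums[OF summable_a]]) simp
  have "(\<Sum>k. stage_utility ?a (k + n)) < (\<Sum>k. stage_utility ?b (k + n))"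
    unfolding sums_unique[OF grouped]
    by (intro suminf_strict_mono less summable_b sums_summable[OF grouped])
  moreover have "(\<Sum>k<n. stage_utility ?a k) = (\<Sum>k<n. stage_utility ?b k)"
    by (intro sum.cong) (auto simp: stage_utility_def power_law_utility_def)
  ultimately have "sequence_utility ?a < sequence_utility ?b"
    unfolding sequence_utility_def
      suminf_split_initial_segment[OF summable_stage_utility, of _ n] by linarith
  then show ?thesis ..
qed

text \<open>Sequences may take values outside the action set, where rewards and times agree with
  action 1. Projecting onto {1, 2} yields an admissible strategy, so optimality bounds the utility
  of all sequences.\<close>

lemma sequence_utility_project:
  "sequence_utility (\<lambda>k. if a k = 2 then 2 else 1) = sequence_utility a"
proof -
  have "stage_utility (\<lambda>k. if a k = 2 then 2 else 1) = stage_utility a"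
    by (simp add: stage_utility_def fun_eq_iff if_distrib if_distribR cong: if_cong)
  then show ?thesis
    by (simp add: sequence_utility_def)
qed

lemma stationary_not_optimal:
  assumes p: "p \<in> prob_vectors {1..2}"
  shows "expected_utility (\<lambda>_. p) \<noteq> (SUP \<sigma>\<in>strategies {1..2}. expected_utility \<sigma>)"
proof
  assume eq: "expected_utility (\<lambda>_. p) = (SUP \<sigma>\<in>strategies {1..2}. expected_utility \<sigma>)"
  have opt: "sequence_utility a \<le> expected_utility (\<lambda>_. p)" for a
  proof -
    let ?a = "\<lambda>k. if a k = 2 then 2 else 1"
    have "expected_utility (\<lambda>k. return_pmf (?a k)) \<le> expected_utility (\<lambda>_. p)"
      unfolding eq
      by (intro cSUP_upper bdd_aboveI2[OF expected_utility_le])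
        (auto simp: strategies_def prob_vectors_def)
    then show ?thesis
      by (simp only: expected_utility_return_pmf sequence_utility_project)
  qed
  obtain i where "i \<in> set_pmf p"
    using set_pmf_not_empty[of p] by blast
  then have "sequence_utility (\<lambda>_. i) = expected_utility (\<lambda>_. p)"
    by (intro constant_sequence_optimal opt) (simp add: pmf_positive)
  moreover have "i \<in> {1..2}"
    using p \<open>i \<in> set_pmf p\<close> unfolding prob_vectors_def by blast
  then have "i = 1 \<or> i = 2"
    by auto
  ultimately show False
    using opt slow_sequence_suboptimal fast_sequence_suboptimal by (metis not_le)
qed

end

theorem proposition4:
  fixes \<alpha> :: real
  assumes "\<alpha> > 1"
  shows "\<exists>G. stateless_mean_field_game G \<and> utility G = power_law_utility \<alpha> \<and>
             continuous_sojourn G \<and> rate_monotonous G \<and>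
             stationary_equilibria G = {}"
proof -
  \<comment> \<open>\<alpha> > 1 leaves room for R strictly between 2 and 2 powr \<alpha>.\<close>
  have "(2 :: real) powr 1 < 2 powr \<alpha>"
    using assms by (intro powr_less_mono) auto
  then obtain R :: real where R: "2 < R" "R < 2 powr \<alpha>"
    using dense by auto
  interpret slow_and_fast_action \<alpha> R
    by unfold_locales (use assms R in auto)
  define G where "G = \<lparr>mass = 1, num_actions = 2, reward = (\<lambda>i. if i = 2 then R else 1),
    sojourn = (\<lambda>i _. if i = 2 then 2 else 1), utility = power_law_utility \<alpha>\<rparr>"
  have A: "actions G = {1..2}"
    by (simp add: actions_def G_def)
  \<comment> \<open>Constant sojourn times make the decision problem independent of \<mu>, so the
    optimality condition fails at every mass distribution.\<close>
  have "total_utility G \<sigma> (\<lambda>i. sojourn G i \<mu>) = expected_utility \<sigma>" for \<sigma> \<mu>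
    by (simp add: total_utility_def expected_utility_def sequence_utility_def stage_utility_def G_def)
  then have "stationary_equilibria G = {}"
    using stationary_not_optimal by (auto simp: stationary_equilibria_def A)
  moreover have "stateless_mean_field_game G" "continuous_sojourn G" "rate_monotonous G"
    "utility G = power_law_utility \<alpha>"
    using R by (auto simp: stateless_mean_field_game_def continuous_sojourn_def
        rate_monotonous_def G_def)
  ultimately show ?thesis
    by blast
qed

end
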